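(* Let $\alpha_1,\alpha_2,\beta$ be real numbers such that none of the denominators occurring below vanishes, let $b_n,c_n,d_n$ be the Jacobi–Piñeiro recurrence coefficients given in the context, and let $T_m$ be the corresponding tetradiagonal matrices. For $n\ge0$ set $$a_{6n+1}=\frac{(\alpha_1+1+n)(\alpha_1+\beta+2n+1)(\alpha_2+\beta+2n+1)}{(\alpha_1+\beta+3n+1)_2(\alpha_2+\beta+3n+1)},\qquad a_{6n+4}=\frac{(\alpha_2+1+n)(\alpha_1+\beta+2n+2)(\alpha_2+\beta+2n+2)}{(\alpha_1+\beta+3n+3)(\alpha_2+\beta+3n+2)_2},$$ $$a_{6n+2}=\frac{(\beta+2n+1)(\alpha_2-\alpha_1+n)(\alpha_2+\beta+2n+1)}{(\alpha_1+\beta+3n+2)(\alpha_2+\beta+3n+1)_2},\qquad a_{6n+5}=\frac{(n+1)(\beta+2n+2)(\alpha_2+\beta+2n+2)}{(\alpha_1+\beta+3n+3)_2(\alpha_2+\beta+3n+3)},$$ $$a_{6n+3}=\frac{(\beta+2n+1)(\alpha_1-\alpha_2+n+1)(\alpha_1+\beta+2n+2)}{(\alpha_1+\beta+3n+2)_2(\alpha_2+\beta+3n+2)},\qquad a_{6n+6}=\frac{(n+1)(\beta+2n+2)(\alpha_1+\beta+2n+3)}{(\alpha_1+\beta+3n+4)(\alpha_2+\beta+3n+3)_2}.$$ Then for every $m\ge1$ one has $T_m=L_{1,m}L_{2,m}U_m$, with $L_{1,m},L_{2,m},U_m$ built from these $a_n$ as in the context. Moreover, if $\alpha_1,\alpha_2,\beta>-1$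 and $-1<\alpha_1-\alpha_2<0$, then $a_n>0$ for all $n\ge1$.
   Context: Matrices. Given sequences $(b_n)_{n\ge0},(c_n)_{n\ge1},(d_n)_{n\ge2}$, $T_m$ is the $m\times m$ matrix (rows and columns numbered from $1$) with $(T_m)_{i,i}=b_{i-1}$, $(T_m)_{i,i+1}=1$, $(T_m)_{i+1,i}=c_i$, $(T_m)_{i+2,i}=d_{i+1}$ and all other entries $0$. Given $(a_n)_{n\ge1}$: $L_{1,m}$ is the $m\times m$ lower bidiagonal matrix with $1$'s on the diagonal and $(L_{1,m})_{i+1,i}=a_{3i-1}$; $L_{2,m}$ is lower bidiagonal with $1$'s on the diagonal and $(L_{2,m})_{i+1,i}=a_{3i}$; $U_m$ is upper bidiagonal with diagonal entries $(U_m)_{i,i}=a_{3i-2}$ and $1$'s on the superdiagonal. Notation. $(x)_2=x(x+1)$. Fractions are read as rational functions of the parameters, after cancellation of common factors (in particular an expression with factor $n_1=0$ in the numerator is $0$). Auxiliary functions of $(n_1,n_2,\alpha_1,\alpha_2)$ (with $\beta$ fixed): $$A=\frac{n_1(n_1+n_2+\alpha_2+\beta)(n_1+n_2+\beta)}{(n_1+2n_2+\alpha_2+\beta)(2n_1+n_2+\alpha_1+\beta)(2n_1+n_2+\alpha_1+\beta+1)},$$ $$B=\frac{(n_1+\alpha_1-\alpha_2)(n_1+n_2+\alpha_1+\beta)(n_1+n_2+\beta-1)}{(n_1+2n_2+\alpha_2+\beta-1)(2n_1+n_2+\alpha_1+\beta)(2n_1+n_2+\alpha_1+\beta-1)},$$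 $$C=\frac{(n_1+\alpha_1)(n_1+n_2+\alpha_1+\beta-1)(n_1+n_2+\alpha_2+\beta-1)}{(n_1+2n_2+\alpha_2+\beta-2)(2n_1+n_2+\alpha_1+\beta-2)(2n_1+n_2+\alpha_1+\beta-1)}.$$ Jacobi–Piñeiro recurrence coefficients ($A(n_1,n_2,x,y)$ means $\alpha_1$ replaced by $x$ and $\alpha_2$ by $y$): $b_{2k}=A(k,k,\alpha_1,\alpha_2)+A(k,k,\alpha_2,\alpha_1+1)+C(k+1,k+1,\alpha_1,\alpha_2)$; $b_{2k+1}=A(k,k+1,\alpha_2,\alpha_1)+A(k+1,k,\alpha_1,\alpha_2+1)+C(k+1,k+2,\alpha_2,\alpha_1)$; $c_{2k}=\big(A(k,k,\alpha_1,\alpha_2)+A(k,k,\alpha_2,\alpha_1+1)\big)C(k,k+1,\alpha_2,\alpha_1)+A(k,k,\alpha_1,\alpha_2)B(k,k,\alpha_1,\alpha_2)$; $c_{2k+1}=\big(A(k,k+1,\alpha_2,\alpha_1)+A(k+1,k,\alpha_1,\alpha_2+1)\big)C(k+1,k+1,\alpha_1,\alpha_2)+A(k,k+1,\alpha_2,\alpha_1)B(k,k+1,\alpha_2,\alpha_1)$; $d_{2k}=A(k,k,\alpha_1,\alpha_2)B(k,k,\alpha_1,\alpha_2)C(k,k,\alpha_1,\alpha_2)$; $d_{2k+1}=A(k,k+1,\alpha_2,\alpha_1)B(k,k+1,\alpha_2,\alpha_1)C(k,k+1,\alpha_2,\alpha_1)$. *)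

theory Defs
  imports
    "HOL-Computational_Algebra.Computational_Algebra"
    "HOL-Computational_Algebra.Field_as_Ring"
    "Jordan_Normal_Form.Matrix"
begin

definition jp_A :: "'a::field \<Rightarrow> nat \<Rightarrow> nat \<Rightarrow> 'a \<Rightarrow> 'a \<Rightarrow> 'a" where
  "jp_A \<beta> n1 n2 \<alpha>1 \<alpha>2 =
     of_nat n1 * (of_nat n1 + of_nat n2 + \<alpha>2 + \<beta>) * (of_nat n1 + of_nat n2 + \<beta>) /
     ((of_nat n1 + 2 * of_nat n2 + \<alpha>2 + \<beta>)
      * (2 * of_nat n1 + of_nat n2 + \<alpha>1 + \<beta>)
      * (2 * of_nat n1 + of_nat n2 + \<alpha>1 + \<beta> + 1))"

definition jp_B :: "'a::field \<Rightarrow> nat \<Rightarrow> nat \<Rightarrow> 'a \<Rightarrow> 'a \<Rightarrow> 'a" where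
  "jp_B \<beta> n1 n2 \<alpha>1 \<alpha>2 =
     (of_nat n1 + \<alpha>1 - \<alpha>2) * (of_nat n1 + of_nat n2 + \<alpha>1 + \<beta>)
      * (of_nat n1 + of_nat n2 + \<beta> - 1) /
     ((of_nat n1 + 2 * of_nat n2 + \<alpha>2 + \<beta> - 1)
      * (2 * of_nat n1 + of_nat n2 + \<alpha>1 + \<beta>)
      * (2 * of_nat n1 + of_nat n2 + \<alpha>1 + \<beta> - 1))"

definition jp_C :: "'a::field \<Rightarrow> nat \<Rightarrow> nat \<Rightarrow> 'a \<Rightarrow> 'a \<Rightarrow> 'a" where
  "jp_C \<beta> n1 n2 \<alpha>1 \<alpha>2 =
     (of_nat n1 + \<alpha>1) * (of_nat n1 + of_nat n2 + \<alpha>1 + \<beta> - 1)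
      * (of_nat n1 + of_nat n2 + \<alpha>2 + \<beta> - 1) /
     ((of_nat n1 + 2 * of_nat n2 + \<alpha>2 + \<beta> - 2)
      * (2 * of_nat n1 + of_nat n2 + \<alpha>1 + \<beta> - 2)
      * (2 * of_nat n1 + of_nat n2 + \<alpha>1 + \<beta> - 1))"

definition jp_b :: "'a::field \<Rightarrow> 'a \<Rightarrow> 'a \<Rightarrow> nat \<Rightarrow> 'a" where
  "jp_b \<alpha>1 \<alpha>2 \<beta> n = (let k = n div 2 in
     if even n
     then jp_A \<beta> k k \<alpha>1 \<alpha>2 + jp_A \<beta> k k \<alpha>2 (\<alpha>1 + 1) + jp_C \<beta> (k+1) (k+1) \<alpha>1 \<alpha>2
     else jp_A \<beta> k (k+1) \<alpha>2 \<alpha>1 + jp_A \<beta> (k+1) k \<alpha>1 (\<alpha>2 + 1) + jp_C \<beta> (k+1) (k+2) \<alpha>2 \<alpha>1)"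

definition jp_c :: "'a::field \<Rightarrow> 'a \<Rightarrow> 'a \<Rightarrow> nat \<Rightarrow> 'a" where
  "jp_c \<alpha>1 \<alpha>2 \<beta> n = (let k = n div 2 in
     if even n
     then (jp_A \<beta> k k \<alpha>1 \<alpha>2 + jp_A \<beta> k k \<alpha>2 (\<alpha>1 + 1)) * jp_C \<beta> k (k+1) \<alpha>2 \<alpha>1
          + jp_A \<beta> k k \<alpha>1 \<alpha>2 * jp_B \<beta> k k \<alpha>1 \<alpha>2
     else (jp_A \<beta> k (k+1) \<alpha>2 \<alpha>1 + jp_A \<beta> (k+1) k \<alpha>1 (\<alpha>2 + 1)) * jp_C \<beta> (k+1) (k+1) \<alpha>1 \<alpha>2
          + jp_A \<beta> k (k+1) \<alpha>2 \<alpha>1 * jp_B \<beta> k (k+1) \<alpha>2 \<alpha>1)"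

definition jp_d :: "'a::field \<Rightarrow> 'a \<Rightarrow> 'a \<Rightarrow> nat \<Rightarrow> 'a" where
  "jp_d \<alpha>1 \<alpha>2 \<beta> n = (let k = n div 2 in
     if even n
     then jp_A \<beta> k k \<alpha>1 \<alpha>2 * jp_B \<beta> k k \<alpha>1 \<alpha>2 * jp_C \<beta> k k \<alpha>1 \<alpha>2
     else jp_A \<beta> k (k+1) \<alpha>2 \<alpha>1 * jp_B \<beta> k (k+1) \<alpha>2 \<alpha>1 * jp_C \<beta> k (k+1) \<alpha>2 \<alpha>1)"

text \<open>For \<open>i \<ge> 1\<close>, \<open>i = 6 * ((i - 1) div 6) + r\<close> with \<open>r \<in> {1..6}\<close>;
  the case \<open>r = 6\<close> is the last branch. The value at \<open>i = 0\<close> is irrelevant.\<close>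

definition jp_a :: "'a::field \<Rightarrow> 'a \<Rightarrow> 'a \<Rightarrow> nat \<Rightarrow> 'a" where
  "jp_a \<alpha>1 \<alpha>2 \<beta> i = (let n = of_nat ((i - 1) div 6) in
     if i mod 6 = 1 then
       (\<alpha>1 + 1 + n) * (\<alpha>1 + \<beta> + 2*n + 1) * (\<alpha>2 + \<beta> + 2*n + 1) /
       (pochhammer (\<alpha>1 + \<beta> + 3*n + 1) 2 * (\<alpha>2 + \<beta> + 3*n + 1))
     else if i mod 6 = 2 then
       (\<beta> + 2*n + 1) * (\<alpha>2 - \<alpha>1 + n) * (\<alpha>2 + \<beta> + 2*n + 1) /
       ((\<alpha>1 + \<beta> + 3*n + 2) * pochhammer (\<alpha>2 + \<beta> + 3*n + 1) 2)
     else if i mod 6 = 3 then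
       (\<beta> + 2*n + 1) * (\<alpha>1 - \<alpha>2 + n + 1) * (\<alpha>1 + \<beta> + 2*n + 2) /
       (pochhammer (\<alpha>1 + \<beta> + 3*n + 2) 2 * (\<alpha>2 + \<beta> + 3*n + 2))
     else if i mod 6 = 4 then
       (\<alpha>2 + 1 + n) * (\<alpha>1 + \<beta> + 2*n + 2) * (\<alpha>2 + \<beta> + 2*n + 2) /
       ((\<alpha>1 + \<beta> + 3*n + 3) * pochhammer (\<alpha>2 + \<beta> + 3*n + 2) 2)
     else if i mod 6 = 5 then
       (n + 1) * (\<beta> + 2*n + 2) * (\<alpha>2 + \<beta> + 2*n + 2) /
       (pochhammer (\<alpha>1 + \<beta> + 3*n + 3) 2 * (\<alpha>2 + \<beta> + 3*n + 3))
     else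
       (n + 1) * (\<beta> + 2*n + 2) * (\<alpha>1 + \<beta> + 2*n + 3) /
       ((\<alpha>1 + \<beta> + 3*n + 4) * pochhammer (\<alpha>2 + \<beta> + 3*n + 3) 2))"

text \<open>Over the reals a factor such as \<open>\<alpha>1 + \<beta> + 1\<close> that occurs in both the numerator and
  the denominator (for instance in \<open>a\<^sub>1\<close>) would turn the quotient into \<open>x / 0 = 0\<close> where it
  vanishes, and this happens for some parameters \<open>> -1\<close>. The expressions are therefore formed
  in the field \<open>\<real>(\<alpha>1, \<alpha>2, \<beta>)\<close> and evaluated in lowest terms, as returned by
  \<^const>\<open>quot_of_fract\<close>. In the nested polynomial type \<open>\<beta>\<close> is the outermost variable and
  \<open>\<alpha>1\<close> the innermost.\<close>

type_synonym ratfun = "real poly poly poly fract"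

definition X_\<alpha>1 :: ratfun where "X_\<alpha>1 = Fraction_Field.Fract [:[:[:0, 1:]:]:] 1"
definition X_\<alpha>2 :: ratfun where "X_\<alpha>2 = Fraction_Field.Fract [:[:0, 1:]:] 1"
definition X_\<beta> :: ratfun where "X_\<beta> = Fraction_Field.Fract [:0, 1:] 1"

definition eval3 :: "real \<Rightarrow> real \<Rightarrow> real \<Rightarrow> real poly poly poly \<Rightarrow> real" where
  "eval3 \<alpha>1 \<alpha>2 \<beta> p = poly (poly (poly p [:[:\<beta>:]:]) [:\<alpha>2:]) \<alpha>1"

definition rf_num :: "ratfun \<Rightarrow> real poly poly poly" where
  "rf_num r = fst (quot_of_fract r)"

definition rf_denom :: "ratfun \<Rightarrow> real poly poly poly" where
  "rf_denom r = snd (quot_of_fract r)"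

definition rf_defined_at :: "real \<Rightarrow> real \<Rightarrow> real \<Rightarrow> ratfun \<Rightarrow> bool" where
  "rf_defined_at \<alpha>1 \<alpha>2 \<beta> r \<longleftrightarrow> eval3 \<alpha>1 \<alpha>2 \<beta> (rf_denom r) \<noteq> 0"

definition rf_eval :: "real \<Rightarrow> real \<Rightarrow> real \<Rightarrow> ratfun \<Rightarrow> real" where
  "rf_eval \<alpha>1 \<alpha>2 \<beta> r = eval3 \<alpha>1 \<alpha>2 \<beta> (rf_num r) / eval3 \<alpha>1 \<alpha>2 \<beta> (rf_denom r)"

abbreviation "a_rf \<equiv> jp_a X_\<alpha>1 X_\<alpha>2 X_\<beta>"
abbreviation "b_rf \<equiv> jp_b X_\<alpha>1 X_\<alpha>2 X_\<beta>"
abbreviation "c_rf \<equiv> jp_c X_\<alpha>1 X_\<alpha>2 X_\<beta>"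
abbreviation "d_rf \<equiv> jp_d X_\<alpha>1 X_\<alpha>2 X_\<beta>"

text \<open>\<^const>\<open>mat\<close> indexes rows and columns from 0; here the entry function is given with
  indices from 1.\<close>

definition mat1 :: "nat \<Rightarrow> (nat \<Rightarrow> nat \<Rightarrow> real) \<Rightarrow> real mat" where
  "mat1 m f = mat m m (\<lambda>(i, j). f (i + 1) (j + 1))"

definition T_mat :: "(nat \<Rightarrow> real) \<Rightarrow> (nat \<Rightarrow> real) \<Rightarrow> (nat \<Rightarrow> real) \<Rightarrow> nat \<Rightarrow> real mat" where
  "T_mat b c d m = mat1 m (\<lambda>i j.
     if i = j then b (i - 1)
     else if j = i + 1 then 1
     else if i = j + 1 then c j
     else if i = j + 2 then d (j + 1)
     else 0)"

definition L1_mat :: "(nat \<Rightarrow> real) \<Rightarrow> nat \<Rightarrow> real mat" where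
  "L1_mat a m = mat1 m (\<lambda>i j. if i = j then 1 else if i = j + 1 then a (3 * j - 1) else 0)"

definition L2_mat :: "(nat \<Rightarrow> real) \<Rightarrow> nat \<Rightarrow> real mat" where
  "L2_mat a m = mat1 m (\<lambda>i j. if i = j then 1 else if i = j + 1 then a (3 * j) else 0)"

definition U_mat :: "(nat \<Rightarrow> real) \<Rightarrow> nat \<Rightarrow> real mat" where
  "U_mat a m = mat1 m (\<lambda>i j. if i = j then a (3 * i - 2) else if j = i + 1 then 1 else 0)"

end

theory Submission
  imports Defs
begin

text \<open>Write \<open>A\<close>, \<open>A'\<close> for the two values of the function \<open>A\<close> in a recurrence coefficient. Each of
  \<open>A\<close>, \<open>A'\<close>, \<open>B\<close>, \<open>C\<close> is one of the \<open>a\<^sub>i\<close>, except at odd indices, where only \<open>A + A'\<close> and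
  \<open>A B\<close> match the sum and the product of two \<open>a\<^sub>i\<close>. The entries of \<open>L\<^sub>1 L\<^sub>2 U\<close> therefore
  agree with those of \<open>T\<close> as rational functions, and evaluation in lowest terms is a ring
  homomorphism on the rational functions defined at a given point. For positivity the only factors
  that can fail to be positive are \<open>\<alpha>\<^sub>i + \<beta> + 1\<close>, and these cancel from \<open>a\<^sub>1\<close> and \<open>a\<^sub>2\<close>.\<close>

section \<open>Evaluation of rational functions\<close>

lemma eval3_simps [simp]:
  "eval3 x y z (p + q) = eval3 x y z p + eval3 x y z q"
  "eval3 x y z (p - q) = eval3 x y z p - eval3 x y z q"
  "eval3 x y z (p * q) = eval3 x y z p * eval3 x y z q"
  "eval3 x y z 0 = 0"
  "eval3 x y z 1 = 1"
  by (simp_all add: eval3_def)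

lemma eval3_of_nat [simp]: "eval3 x y z (of_nat n) = of_nat n"
  by (induction n) auto

definition has_value :: "real \<Rightarrow> real \<Rightarrow> real \<Rightarrow> ratfun \<Rightarrow> real \<Rightarrow> bool" where
  "has_value x y z r v \<longleftrightarrow> (\<exists>p q. eval3 x y z q \<noteq> 0 \<and> r = to_fract p / to_fract q \<and>
     v = eval3 x y z p / eval3 x y z q)"

lemma ratfun_eq: "r = to_fract (rf_num r) / to_fract (rf_denom r)"
  unfolding rf_num_def rf_denom_def
  by (metis Fract_conv_to_fract Fract_quot_of_fract prod.collapse)

lemma rf_denom_nonzero: "rf_denom r \<noteq> 0"
  by (simp add: rf_denom_def)

lemma has_value_rf_eval:
  assumes "rf_defined_at x y z r"
  shows "has_value x y z r (rf_eval x y z r)"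
  using assms ratfun_eq[of r] unfolding has_value_def rf_defined_at_def rf_eval_def by blast

text \<open>By coprimality the reduced denominator divides the denominator \<open>q\<close> of every
  other representation. Hence it cannot vanish where \<open>q\<close> does not, and
  cross-multiplication gives equal quotients.\<close>

lemma rf_eval_eq:
  assumes "has_value x y z r v"
  shows "rf_eval x y z r = v"
proof -
  obtain p q where q: "eval3 x y z q \<noteq> 0" and r: "r = to_fract p / to_fract q"
    and v: "v = eval3 x y z p / eval3 x y z q"
    using assms unfolding has_value_def by blast
  have "q \<noteq> 0"
    using q by auto
  have "to_fract (rf_num r) / to_fract (rf_denom r) = to_fract p / to_fract q"
    using ratfun_eq[of r] r by simp
  hence "to_fract (rf_num r * q) = to_fract (p * rf_denom r)"
    using \<open>q \<noteq> 0\<close> rf_denom_nonzero[of r] by (simp add: frac_eq_eq)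
  hence eq: "rf_num r * q = p * rf_denom r"
    by (simp only: to_fract_eq_iff)
  have "coprime (rf_denom r) (rf_num r)"
    unfolding rf_num_def rf_denom_def by (metis coprime_quot_of_fract coprime_commute)
  moreover have "rf_denom r dvd rf_num r * q"
    by (simp add: eq)
  ultimately obtain s where "q = rf_denom r * s"
    by (auto simp: coprime_dvd_mult_right_iff)
  hence "eval3 x y z (rf_denom r) \<noteq> 0"
    using q by auto
  moreover have "eval3 x y z (rf_num r) * eval3 x y z q = eval3 x y z p * eval3 x y z (rf_denom r)"
    using arg_cong[OF eq, of "eval3 x y z"] by simp
  ultimately show ?thesis
    using q v by (simp add: rf_eval_def frac_eq_eq)
qed

lemma has_value_to_fract: "has_value x y z (to_fract p) (eval3 x y z p)"
  unfolding has_value_def by (intro exI[of _ p] exI[of _ 1]) simp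

lemma has_value_X:
  "has_value x y z X_\<alpha>1 x" "has_value x y z X_\<alpha>2 y" "has_value x y z X_\<beta> z"
  using has_value_to_fract[of x y z "[:[:[:0, 1:]:]:]"] has_value_to_fract[of x y z "[:[:0, 1:]:]"]
    has_value_to_fract[of x y z "[:0, 1:]"]
  by (simp_all add: X_\<alpha>1_def X_\<alpha>2_def X_\<beta>_def to_fract_def eval3_def)

lemma has_value_of_nat: "has_value x y z (of_nat n) (of_nat n)"
proof -
  have "to_fract (of_nat n :: real poly poly poly) = of_nat n"
    by (induction n) auto
  thus ?thesis
    using has_value_to_fract[of x y z "of_nat n"] by simp
qed

lemma has_value_const:
  "has_value x y z 1 1" "has_value x y z (numeral k) (numeral k)"
  using has_value_of_nat[of x y z 1] has_value_of_nat[of x y z "numeral k"] by simp_all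

lemma has_value_nonzero:
  assumes "has_value x y z r v" "v \<noteq> 0"
  shows "r \<noteq> 0"
  using assms unfolding has_value_def by auto

lemma has_value_arith:
  assumes "has_value x y z r v" "has_value x y z s w"
  shows "has_value x y z (r + s) (v + w)"
    and "has_value x y z (r - s) (v - w)"
    and "has_value x y z (r * s) (v * w)"
proof -
  obtain p q where q: "eval3 x y z q \<noteq> 0" and r: "r = to_fract p / to_fract q"
    and v: "v = eval3 x y z p / eval3 x y z q"
    using assms unfolding has_value_def by blast
  obtain p' q' where q': "eval3 x y z q' \<noteq> 0" and s: "s = to_fract p' / to_fract q'"
    and w: "w = eval3 x y z p' / eval3 x y z q'"
    using assms unfolding has_value_def by blast
  have nz: "q \<noteq> 0" "q' \<noteq> 0"
    using q q' by auto
  show "has_value x y z (r + s) (v + w)"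
    unfolding has_value_def using q q' nz
    by (intro exI[of _ "p * q' + p' * q"] exI[of _ "q * q'"]) (simp add: r s v w add_frac_eq)
  show "has_value x y z (r - s) (v - w)"
    unfolding has_value_def using q q' nz
    by (intro exI[of _ "p * q' - p' * q"] exI[of _ "q * q'"]) (simp add: r s v w diff_frac_eq)
  show "has_value x y z (r * s) (v * w)"
    unfolding has_value_def using q q' nz
    by (intro exI[of _ "p * p'"] exI[of _ "q * q'"]) (simp add: r s v w)
qed

lemma has_value_divide:
  assumes "has_value x y z r v" "has_value x y z s w" "w \<noteq> 0"
  shows "has_value x y z (r / s) (v / w)"
proof -
  obtain p q where q: "eval3 x y z q \<noteq> 0" and s: "s = to_fract p / to_fract q"
    and w: "w = eval3 x y z p / eval3 x y z q"
    using assms unfolding has_value_def by blast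
  have "eval3 x y z p \<noteq> 0"
    using assms w by auto
  hence "has_value x y z (to_fract q / to_fract p) (eval3 x y z q / eval3 x y z p)"
    unfolding has_value_def by blast
  from has_value_arith(3)[OF assms(1) this] show ?thesis
    by (simp add: s w)
qed

lemmas has_value_intros =
  has_value_X has_value_of_nat has_value_const has_value_arith has_value_divide

text \<open>One point with a nonzero value suffices: at (1, 1, 0) both sums take the value n +
  1.\<close>

lemma X_sum_nonzero:
  "X_\<alpha>1 + X_\<beta> + of_nat n \<noteq> 0" "X_\<alpha>2 + X_\<beta> + of_nat n \<noteq> 0"
  by (rule has_value_nonzero[of 1 1 0 _ "1 + 0 + of_nat n"]; (intro has_value_intros)?; simp)+

section \<open>The recurrence coefficients in terms of the \<open>a\<^sub>i\<close>\<close>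

lemma pochhammer_2: "pochhammer x 2 = x * (x + 1)"
  by (simp add: numeral_2_eq_2 pochhammer_Suc)

text \<open>Stated over any field because the positivity proof expands \<open>jp_a\<close> both over
  the rational functions and over the reals.\<close>

lemma jp_a_simps:
  fixes x y z :: "'a::field"
  shows
  "jp_a x y z (6 * k + 1) = (x + 1 + of_nat k) * (x + z + 2 * of_nat k + 1) * (y + z + 2 * of_nat k + 1) /
     ((x + z + 3 * of_nat k + 1) * (x + z + 3 * of_nat k + 2) * (y + z + 3 * of_nat k + 1))"
    (is ?t1)
  "jp_a x y z (6 * k + 2) = (z + 2 * of_nat k + 1) * (y - x + of_nat k) * (y + z + 2 * of_nat k + 1) /
     ((x + z + 3 * of_nat k + 2) * (y + z + 3 * of_nat k + 1) * (y + z + 3 * of_nat k + 2))"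
    (is ?t2)
  "jp_a x y z (6 * k + 3) = (z + 2 * of_nat k + 1) * (x - y + of_nat k + 1) * (x + z + 2 * of_nat k + 2) /
     ((x + z + 3 * of_nat k + 2) * (x + z + 3 * of_nat k + 3) * (y + z + 3 * of_nat k + 2))"
    (is ?t3)
  "jp_a x y z (6 * k + 4) = (y + 1 + of_nat k) * (x + z + 2 * of_nat k + 2) * (y + z + 2 * of_nat k + 2) /
     ((x + z + 3 * of_nat k + 3) * (y + z + 3 * of_nat k + 2) * (y + z + 3 * of_nat k + 3))"
    (is ?t4)
  "jp_a x y z (6 * k + 5) = (of_nat k + 1) * (z + 2 * of_nat k + 2) * (y + z + 2 * of_nat k + 2) /
     ((x + z + 3 * of_nat k + 3) * (x + z + 3 * of_nat k + 4) * (y + z + 3 * of_nat k + 3))"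
    (is ?t5)
  "jp_a x y z (6 * k + 6) = (of_nat k + 1) * (z + 2 * of_nat k + 2) * (x + z + 2 * of_nat k + 3) /
     ((x + z + 3 * of_nat k + 4) * (y + z + 3 * of_nat k + 3) * (y + z + 3 * of_nat k + 4))"
    (is ?t6)
proof -
  have "Suc (k * 6) div 6 = k" "Suc (Suc (k * 6)) div 6 = k"
    by presburger+
  thus ?t1 ?t2 ?t3 ?t4 ?t5 ?t6
    by (simp_all add: jp_a_def Let_def pochhammer_2 mod_Suc ac_simps)
qed

context
  fixes x y z :: "'a::field"
begin

text \<open>Numerators and denominators agree separately, so nothing is cancelled. The shift to k +
  1 keeps the index on the right positive; for k = 0 the function \<open>jp_A\<close> vanishes
  instead.\<close>

lemma jp_A_even:
  "jp_A z (k + 1) (k + 1) x y = jp_a x y z (6 * k + 5)"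
  "jp_A z (k + 1) (k + 1) y (x + 1) = jp_a x y z (6 * k + 6)"
  unfolding jp_A_def jp_a_simps
  by (rule arg_cong2[where f = "(/)"]; simp add: algebra_simps)+

lemma jp_B_even: "jp_B z (k + 1) (k + 1) x y = jp_a x y z (6 * k + 3)"
  unfolding jp_B_def jp_a_simps
  by (rule arg_cong2[where f = "(/)"]; simp add: algebra_simps)

lemma jp_C_even: "jp_C z (k + 1) (k + 1) x y = jp_a x y z (6 * k + 1)"
  unfolding jp_C_def jp_a_simps
  by (rule arg_cong2[where f = "(/)"]; simp add: algebra_simps)

lemma jp_C_odd: "jp_C z (k + 1) (k + 2) y x = jp_a x y z (6 * k + 4)"
  unfolding jp_C_def jp_a_simps
  by (rule arg_cong2[where f = "(/)"]; simp add: algebra_simps)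

text \<open>The first factors on both sides share their denominator and the numerator factor
  \<open>z + 2 * \<kappa> + 3\<close>; the second factors share theirs and
  \<open>z + 2 * \<kappa> + 2\<close>. The remaining pairs of numerator factors are merely
  exchanged.\<close>

lemma jp_AB_odd:
  "jp_A z (k + 1) (k + 2) y x * jp_B z (k + 1) (k + 2) y x =
     jp_a x y z (6 * (k + 1) + 2) * jp_a x y z (6 * k + 6)"
proof -
  define \<kappa> :: 'a where "\<kappa> = of_nat k"
  have "jp_A z (k + 1) (k + 2) y x = (\<kappa> + 1) * (x + z + 2 * \<kappa> + 3) * (z + 2 * \<kappa> + 3) /
      ((x + z + 3 * \<kappa> + 5) * (y + z + 3 * \<kappa> + 4) * (y + z + 3 * \<kappa> + 5))"
    unfolding jp_A_def \<kappa>_def by (rule arg_cong2[where f = "(/)"]; simp add: algebra_simps)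
  moreover have "jp_B z (k + 1) (k + 2) y x =
      (y - x + \<kappa> + 1) * (y + z + 2 * \<kappa> + 3) * (z + 2 * \<kappa> + 2) /
      ((x + z + 3 * \<kappa> + 4) * (y + z + 3 * \<kappa> + 3) * (y + z + 3 * \<kappa> + 4))"
    unfolding jp_B_def \<kappa>_def by (rule arg_cong2[where f = "(/)"]; simp add: algebra_simps)
  moreover have "jp_a x y z (6 * (k + 1) + 2) =
      (y - x + \<kappa> + 1) * (y + z + 2 * \<kappa> + 3) * (z + 2 * \<kappa> + 3) /
      ((x + z + 3 * \<kappa> + 5) * (y + z + 3 * \<kappa> + 4) * (y + z + 3 * \<kappa> + 5))"
    unfolding jp_a_simps \<kappa>_def by (rule arg_cong2[where f = "(/)"]; simp add: algebra_simps)
  moreover have "jp_a x y z (6 * k + 6) = (\<kappa> + 1) * (x + z + 2 * \<kappa> + 3) * (z + 2 * \<kappa> + 2) /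
      ((x + z + 3 * \<kappa> + 4) * (y + z + 3 * \<kappa> + 3) * (y + z + 3 * \<kappa> + 4))"
    unfolding jp_a_simps \<kappa>_def by (rule arg_cong2[where f = "(/)"]; simp add: algebra_simps)
  ultimately show ?thesis
    by (simp only: times_divide_times_eq mult_ac)
qed

lemma jp_A_0: "jp_A z 0 n u v = 0"
  by (simp add: jp_A_def)

text \<open>This is \<open>jp_A_odd\<close> after a linear change of variables that makes w a common
  factor and leaves only p, p + 1, q, q - 1 in the denominators. Over the common denominator
  \<open>D\<close> it becomes a polynomial identity.\<close>

lemma odd_sum_identity:
  fixes p q k w :: 'a
  assumes "p \<noteq> 0" "p + 1 \<noteq> 0" "q \<noteq> 0" "q - 1 \<noteq> 0"
  shows "k * (p - k - 1) * w / (p * (q - 1) * q) + (k + 1) * (q - k) * w / (q * p * (p + 1)) =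
    w * (q - p + k) * (q - k - 1) / (p * (q - 1) * q) +
    w * (p - q + k + 1) * (p - k) / (p * (p + 1) * q)"
proof -
  define D where "D = p * (p + 1) * q * (q - 1)"
  have D: "D \<noteq> 0"
    using assms by (simp add: D_def)
  have 1: "u / (p * (q - 1) * q) = u * (p + 1) / D" for u
    using assms D by (simp add: D_def frac_eq_eq)
  have 2: "u / (p * (p + 1) * q) = u * (q - 1) / D" "u / (q * p * (p + 1)) = u * (q - 1) / D" for u
    using assms D by (simp_all add: D_def frac_eq_eq)
  show ?thesis
    unfolding 1 2 add_divide_distrib[symmetric]
    by (rule arg_cong2[where f = "(/)"]; simp add: algebra_simps)
qed

lemma jp_A_odd:
  assumes "\<And>n. x + z + of_nat n \<noteq> 0" "\<And>n. y + z + of_nat n \<noteq> 0"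
  shows "jp_A z k (k + 1) y x + jp_A z (k + 1) k x (y + 1) =
    jp_a x y z (6 * k + 2) + jp_a x y z (6 * k + 3)"
proof -
  define p q w \<kappa> where "p = x + z + 3 * of_nat k + 2" and "q = y + z + 3 * of_nat k + 2"
    and "w = z + 2 * of_nat k + 1" and "\<kappa> = (of_nat k :: 'a)"
  note defs = p_def q_def w_def \<kappa>_def
  have "p \<noteq> 0" "p + 1 \<noteq> 0" "q \<noteq> 0" "q - 1 \<noteq> 0"
    using assms(1)[of "3 * k + 2"] assms(1)[of "3 * k + 3"]
      assms(2)[of "3 * k + 2"] assms(2)[of "3 * k + 1"]
    by (simp_all add: defs algebra_simps)
  note eq = odd_sum_identity[OF this, of \<kappa> w]
  have "jp_A z k (k + 1) y x = \<kappa> * (p - \<kappa> - 1) * w / (p * (q - 1) * q)"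
    unfolding jp_A_def defs by (rule arg_cong2[where f = "(/)"]; simp add: algebra_simps)
  moreover have "jp_A z (k + 1) k x (y + 1) = (\<kappa> + 1) * (q - \<kappa>) * w / (q * p * (p + 1))"
    unfolding jp_A_def defs by (rule arg_cong2[where f = "(/)"]; simp add: algebra_simps)
  moreover have "jp_a x y z (6 * k + 2) = w * (q - p + \<kappa>) * (q - \<kappa> - 1) / (p * (q - 1) * q)"
    unfolding jp_a_simps defs by (rule arg_cong2[where f = "(/)"]; simp add: algebra_simps)
  moreover have "jp_a x y z (6 * k + 3) =
      w * (p - q + \<kappa> + 1) * (p - \<kappa>) / (p * (p + 1) * q)"
    unfolding jp_a_simps defs by (rule arg_cong2[where f = "(/)"]; simp add: algebra_simps)
  ultimately show ?thesis
    using eq by simp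
qed

text \<open>The coefficients with index \<open>0\<close> or \<open>1\<close> are separate because the formula for
  \<open>a\<^sub>i\<close> gives a meaningless value, rather than \<open>0\<close>, at \<open>i = 0\<close>.\<close>

lemma recurrence_coeffs:
  assumes nz: "\<And>n. x + z + of_nat n \<noteq> 0" "\<And>n. y + z + of_nat n \<noteq> 0"
  defines "a \<equiv> jp_a x y z"
  shows "jp_b x y z 0 = a 1"
    and "jp_b x y z (n + 1) = a (3 * n + 2) + a (3 * n + 3) + a (3 * n + 4)"
    and "jp_c x y z 1 = (a 2 + a 3) * a 1"
    and "jp_c x y z (n + 2) = (a (3 * n + 5) + a (3 * n + 6)) * a (3 * n + 4) +
      a (3 * n + 5) * a (3 * n + 3)"
    and "jp_d x y z (n + 2) = a (3 * n + 5) * a (3 * n + 3) * a (3 * n + 1)"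
proof -
  note A_odd = jp_A_odd[OF nz]
  have b_even: "jp_b x y z (2 * k) =
      jp_A z k k x y + jp_A z k k y (x + 1) + jp_C z (k + 1) (k + 1) x y"
    and b_odd: "jp_b x y z (2 * k + 1) =
      (jp_A z k (k + 1) y x + jp_A z (k + 1) k x (y + 1)) + jp_C z (k + 1) (k + 2) y x"
    and c_even: "jp_c x y z (2 * k) = (jp_A z k k x y + jp_A z k k y (x + 1)) *
      jp_C z k (k + 1) y x + jp_A z k k x y * jp_B z k k x y"
    and c_odd: "jp_c x y z (2 * k + 1) = (jp_A z k (k + 1) y x + jp_A z (k + 1) k x (y + 1)) *
      jp_C z (k + 1) (k + 1) x y + jp_A z k (k + 1) y x * jp_B z k (k + 1) y x"
    and d_even: "jp_d x y z (2 * k) = jp_A z k k x y * jp_B z k k x y * jp_C z k k x y"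
    and d_odd: "jp_d x y z (2 * k + 1) =
      (jp_A z k (k + 1) y x * jp_B z k (k + 1) y x) * jp_C z k (k + 1) y x" for k
    by (simp_all add: jp_b_def jp_c_def jp_d_def)
  \<comment> \<open>\<open>A_odd\<close> matches the form k + 1 + 1, whereas
    \<open>jp_AB_odd\<close> and \<open>jp_C_odd\<close> match k + 2, so in the odd case of c the
    rewriting with \<open>A_odd\<close> comes before \<open>shift\<close>.\<close>
  have shift: "k + 1 + 1 = k + 2" for k :: nat
    by simp
  show "jp_b x y z 0 = a 1"
    using b_even[of 0] jp_C_even[of 0] by (simp add: a_def jp_A_def)
  show "jp_c x y z 1 = (a 2 + a 3) * a 1"
    using c_odd[of 0] A_odd[of 0] jp_C_even[of 0] by (simp add: a_def jp_A_0 eval_nat_numeral)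
  show "jp_b x y z (n + 1) = a (3 * n + 2) + a (3 * n + 3) + a (3 * n + 4)"
  proof (cases "even n")
    case True
    then obtain k where k: "n = 2 * k" by blast
    show ?thesis
      using b_odd[of k, unfolded A_odd jp_C_odd] by (simp add: k a_def)
  next
    case False
    then obtain k where k: "n = 2 * k + 1" by (rule oddE)
    show ?thesis
      using b_even[of "k + 1", unfolded jp_A_even jp_C_even] by (simp add: k a_def add_ac)
  qed
  show "jp_c x y z (n + 2) = (a (3 * n + 5) + a (3 * n + 6)) * a (3 * n + 4) +
      a (3 * n + 5) * a (3 * n + 3)"
  proof (cases "even n")
    case True
    then obtain k where k: "n = 2 * k" by blast
    show ?thesis
      using c_even[of "k + 1", unfolded jp_A_even jp_B_even shift jp_C_odd] by (simp add: k a_def)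
  next
    case False
    then obtain k where k: "n = 2 * k + 1" by (rule oddE)
    show ?thesis
      using c_odd[of "k + 1", unfolded A_odd jp_C_even, unfolded shift jp_AB_odd]
      by (simp add: k a_def add_ac)
  qed
  show "jp_d x y z (n + 2) = a (3 * n + 5) * a (3 * n + 3) * a (3 * n + 1)"
  proof (cases "even n")
    case True
    then obtain k where k: "n = 2 * k" by blast
    show ?thesis
      using d_even[of "k + 1", unfolded jp_A_even jp_B_even jp_C_even] by (simp add: k a_def)
  next
    case False
    then obtain k where k: "n = 2 * k + 1" by (rule oddE)
    show ?thesis
      using d_odd[of "k + 1", unfolded shift jp_AB_odd jp_C_odd] by (simp add: k a_def add_ac)
  qed
qed

end

section \<open>The factorization\<close>

lemma mat1_index [simp]: "i < m \<Longrightarrow> j < m \<Longrightarrow> mat1 m f $$ (i, j) = f (i + 1) (j + 1)"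
  by (simp add: mat1_def)

lemma mat1_carrier [simp]: "mat1 m f \<in> carrier_mat m m"
  by (simp add: mat1_def)

text \<open>Left multiplication is a row operation. Applied to \<open>L2_mat\<close> and then to
  \<open>L1_mat\<close>, it expresses row i of the triple product through rows i, i - 1 and i - 2 of
  \<open>U_mat\<close>.\<close>

lemma lower_bidiagonal_mult_index:
  fixes l :: "nat \<Rightarrow> real"
  assumes M: "M \<in> carrier_mat m m" and "i < m" "j < m"
  shows "(mat1 m (\<lambda>i j. if i = j then 1 else if i = j + 1 then l j else 0) * M) $$ (i, j) =
    M $$ (i, j) + (if i = 0 then 0 else l i * M $$ (i - 1, j))"
    (is "(?L * M) $$ _ = _")
proof -
  have "(?L * M) $$ (i, j) = (\<Sum>k<m. ?L $$ (i, k) * M $$ (k, j))"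
    using assms by (simp add: scalar_prod_def mat1_def atLeast0LessThan)
  \<comment> \<open>The guard \<open>i \<noteq> 0\<close> is essential, since 0 - 1 = 0 would count
    the diagonal twice. The coefficient is \<open>l i\<close> because column i - 1 has number i when
    counting from 1.\<close>
  also have "\<dots> = (\<Sum>k<m. (if k = i then M $$ (k, j) else 0) +
      (if k = i - 1 \<and> i \<noteq> 0 then l i * M $$ (k, j) else 0))"
    using \<open>i < m\<close> by (intro sum.cong) auto
  also have "\<dots> = M $$ (i, j) + (if i = 0 then 0 else l i * M $$ (i - 1, j))"
    using \<open>i < m\<close> by (auto simp: sum.distrib)
  finally show ?thesis .
qed

lemma tetradiagonal_factorization:
  assumes b: "b 0 = a 1" "\<And>n. b (n + 1) = a (3 * n + 2) + a (3 * n + 3) + a (3 * n + 4)"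
    and c: "c 1 = (a 2 + a 3) * a 1"
      "\<And>n. c (n + 2) = (a (3 * n + 5) + a (3 * n + 6)) * a (3 * n + 4) + a (3 * n + 5) * a (3 * n + 3)"
    and d: "\<And>n. d (n + 2) = a (3 * n + 5) * a (3 * n + 3) * a (3 * n + 1)"
  shows "T_mat b c d m = L1_mat a m * L2_mat a m * U_mat a m"
proof -
  have carrier: "L1_mat a m \<in> carrier_mat m m" "L2_mat a m \<in> carrier_mat m m"
    "U_mat a m \<in> carrier_mat m m" "T_mat b c d m \<in> carrier_mat m m"
    by (simp_all add: L1_mat_def L2_mat_def U_mat_def T_mat_def)
  have L2: "(L2_mat a m * U_mat a m) $$ (i, j) =
      U_mat a m $$ (i, j) + (if i = 0 then 0 else a (3 * i) * U_mat a m $$ (i - 1, j))"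
    if "i < m" "j < m" for i j
    unfolding L2_mat_def by (rule lower_bidiagonal_mult_index) (use that carrier in auto)
  have L1: "(L1_mat a m * (L2_mat a m * U_mat a m)) $$ (i, j) =
      (L2_mat a m * U_mat a m) $$ (i, j) +
      (if i = 0 then 0 else a (3 * i - 1) * (L2_mat a m * U_mat a m) $$ (i - 1, j))"
    if "i < m" "j < m" for i j
    unfolding L1_mat_def by (rule lower_bidiagonal_mult_index) (use that carrier in auto)
  have "T_mat b c d m = L1_mat a m * (L2_mat a m * U_mat a m)"
  proof (rule eq_matI)
    fix i j
    assume "i < dim_row (L1_mat a m * (L2_mat a m * U_mat a m))"
      and "j < dim_col (L1_mat a m * (L2_mat a m * U_mat a m))"
    hence ij: "i < m" "j < m"
      using carrier by auto
    \<comment> \<open>Rows 0 and 1 lack one or both of the preceding rows of \<open>U_mat\<close>;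
      from row 2 on the general formulas for b, c and d apply.\<close>
    consider "i = 0" | "i = 1" | i' where "i = i' + 2"
      by (metis One_nat_def add_2_eq_Suc' not0_implies_Suc)
    thus "T_mat b c d m $$ (i, j) = (L1_mat a m * (L2_mat a m * U_mat a m)) $$ (i, j)"
    proof cases
      case 1
      thus ?thesis
        using ij by (simp add: L1 L2) (auto simp: T_mat_def U_mat_def b)
    next
      case 2
      thus ?thesis
        using ij b(2)[of 0] c(1) by (simp add: L1 L2)
          (auto simp: T_mat_def U_mat_def eval_nat_numeral algebra_simps)
    next
      case 3
      have "j = i + 1 \<or> j = i \<or> j = i' + 1 \<or> j = i' \<or> j > i + 1 \<or> j < i'"
        using 3 by linarith
      thus ?thesis
        using ij b(2)[of "i' + 1"] c(2)[of i'] d[of i'] 3 by (simp add: L1 L2)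
          (auto simp: T_mat_def U_mat_def algebra_simps)
    qed
  qed (use carrier in auto)
  thus ?thesis
    using carrier by (simp add: assoc_mult_mat[of _ m m _ m _ m])
qed

section \<open>Positivity of the coefficients \<open>a\<^sub>i\<close>\<close>

lemma a_rf_1: "a_rf 1 = (X_\<alpha>1 + 1) / (X_\<alpha>1 + X_\<beta> + 2)"
  using jp_a_simps(1)[of X_\<alpha>1 X_\<alpha>2 X_\<beta> 0] X_sum_nonzero[of 1] by simp

lemma a_rf_2: "a_rf 2 = (X_\<beta> + 1) * (X_\<alpha>2 - X_\<alpha>1) / ((X_\<alpha>1 + X_\<beta> + 2) * (X_\<alpha>2 + X_\<beta> + 2))"
proof -
  have "a_rf 2 = (X_\<beta> + 1) * (X_\<alpha>2 - X_\<alpha>1) * (X_\<alpha>2 + X_\<beta> + 1) /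
      ((X_\<alpha>1 + X_\<beta> + 2) * (X_\<alpha>2 + X_\<beta> + 2) * (X_\<alpha>2 + X_\<beta> + 1))"
    by (simp add: jp_a_def pochhammer_2 mult_ac)
  thus ?thesis
    using X_sum_nonzero(2)[of 1] by simp
qed

lemma a_rf_pos:
  assumes pos: "x > -1" "y > -1" "z > -1" "-1 < x - y" "x - y < 0" and "i \<ge> 1"
  shows "rf_eval x y z (a_rf i) > 0"
proof -
  define k where "k = (i - 1) div 6"
  have "(i - 1) mod 6 \<in> {0, 1, 2, 3, 4, 5}"
    using mod_less_divisor[of 6 "i - 1"] by (simp; linarith)
  moreover have "i = 6 * k + (i - 1) mod 6 + 1"
    using \<open>i \<ge> 1\<close> unfolding k_def by simp
  \<comment> \<open>For residues 1 and 2 the factors \<alpha> + \<beta> + 2k + 1 are certainly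
    positive only when k \<ge> 1, as \<alpha> + \<beta> > -2. The indices 1 and 2 use the cancelled
    forms; there y - x > 0 comes from x - y < 0. For residue 3 the bound -1 < x - y gives x - y + k
    + 1 > 0.\<close>
  ultimately consider "i = 1" | "i = 2" | "i = 6 * k + 1" "k \<ge> 1" | "i = 6 * k + 2" "k \<ge> 1"
    | "i = 6 * k + 3" | "i = 6 * k + 4" | "i = 6 * k + 5" | "i = 6 * k + 6"
    by (cases "k = 0") auto
  hence "\<exists>v>0. has_value x y z (a_rf i) v"
  proof cases
    case 1
    have "has_value x y z (a_rf i) ((x + 1) / (x + z + 2))"
      unfolding 1 a_rf_1 using pos by (intro has_value_intros) auto
    thus ?thesis
      using pos by (intro exI conjI) auto
  next
    case 2
    have "has_value x y z (a_rf i) ((z + 1) * (y - x) / ((x + z + 2) * (y + z + 2)))"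
      unfolding 2 a_rf_2 using pos by (intro has_value_intros) auto
    thus ?thesis
      using pos by (intro exI conjI) auto
  next
    case 3
    have "has_value x y z (a_rf i) (jp_a x y z i) \<and> 0 < jp_a x y z i"
      unfolding 3(1) jp_a_simps using pos 3(2)
      by (intro conjI has_value_intros divide_pos_pos mult_pos_pos no_zero_divisors) auto
    thus ?thesis by blast
  next
    case 4
    have "has_value x y z (a_rf i) (jp_a x y z i) \<and> 0 < jp_a x y z i"
      unfolding 4(1) jp_a_simps using pos 4(2)
      by (intro conjI has_value_intros divide_pos_pos mult_pos_pos no_zero_divisors) auto
    thus ?thesis by blast
  next
    case 5
    have "has_value x y z (a_rf i) (jp_a x y z i) \<and> 0 < jp_a x y z i"
      unfolding 5 jp_a_simps using pos
      by (intro conjI has_value_intros divide_pos_pos mult_pos_pos no_zero_divisors) auto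
    thus ?thesis by blast
  next
    case 6
    have "has_value x y z (a_rf i) (jp_a x y z i) \<and> 0 < jp_a x y z i"
      unfolding 6 jp_a_simps using pos
      by (intro conjI has_value_intros divide_pos_pos mult_pos_pos no_zero_divisors) auto
    thus ?thesis by blast
  next
    case 7
    have "has_value x y z (a_rf i) (jp_a x y z i) \<and> 0 < jp_a x y z i"
      unfolding 7 jp_a_simps using pos
      by (intro conjI has_value_intros divide_pos_pos mult_pos_pos no_zero_divisors) auto
    thus ?thesis by blast
  next
    case 8
    have "has_value x y z (a_rf i) (jp_a x y z i) \<and> 0 < jp_a x y z i"
      unfolding 8 jp_a_simps using pos
      by (intro conjI has_value_intros divide_pos_pos mult_pos_pos no_zero_divisors) auto
    thus ?thesis by blast
  qed
  thus ?thesis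
    using rf_eval_eq by blast
qed

theorem proposition3p1:
  fixes \<alpha>1 \<alpha>2 \<beta> :: real and a b c d :: "nat \<Rightarrow> real"
  assumes a_defined: "\<forall>n\<ge>1. rf_defined_at \<alpha>1 \<alpha>2 \<beta> (a_rf n)"
    and b_defined: "\<forall>n. rf_defined_at \<alpha>1 \<alpha>2 \<beta> (b_rf n)"
    and c_defined: "\<forall>n\<ge>1. rf_defined_at \<alpha>1 \<alpha>2 \<beta> (c_rf n)"
    and d_defined: "\<forall>n\<ge>2. rf_defined_at \<alpha>1 \<alpha>2 \<beta> (d_rf n)"
    and a: "\<forall>n\<ge>1. a n = rf_eval \<alpha>1 \<alpha>2 \<beta> (a_rf n)"
    and b: "\<forall>n. b n = rf_eval \<alpha>1 \<alpha>2 \<beta> (b_rf n)"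
    and c: "\<forall>n\<ge>1. c n = rf_eval \<alpha>1 \<alpha>2 \<beta> (c_rf n)"
    and d: "\<forall>n\<ge>2. d n = rf_eval \<alpha>1 \<alpha>2 \<beta> (d_rf n)"
  shows "(\<forall>m\<ge>1. T_mat b c d m = L1_mat a m * L2_mat a m * U_mat a m) \<and>
         (\<alpha>1 > -1 \<and> \<alpha>2 > -1 \<and> \<beta> > -1 \<and> -1 < \<alpha>1 - \<alpha>2 \<and> \<alpha>1 - \<alpha>2 < 0 \<longrightarrow>
           (\<forall>n\<ge>1. a n > 0))"
proof -
  have a_val: "has_value \<alpha>1 \<alpha>2 \<beta> (a_rf n) (a n)" if "n \<ge> 1" for n
    using a_defined a that by (simp add: has_value_rf_eval)
  have valI: "rf_eval \<alpha>1 \<alpha>2 \<beta> r = v" if "r = s" "has_value \<alpha>1 \<alpha>2 \<beta> s v" for r s v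
    using that rf_eval_eq by simp
  \<comment> \<open>The identities are taken over the rational functions, where the sums \<alpha> +
    \<beta> + n are nonzero even if they vanish at the given real point. Only then are both sides
    evaluated, from the known values of the \<open>a\<^sub>i\<close>.\<close>
  note coeffs = recurrence_coeffs[OF X_sum_nonzero]
  note intros = has_value_arith a_val
  have "T_mat b c d m = L1_mat a m * L2_mat a m * U_mat a m" for m
  proof (rule tetradiagonal_factorization)
    show "b 0 = a 1"
      using b valI[OF coeffs(1)] a_val[of 1] by simp
    show "b (n + 1) = a (3 * n + 2) + a (3 * n + 3) + a (3 * n + 4)" for n
      unfolding b[rule_format] by (rule valI[OF coeffs(2)]) (intro intros; simp)
    have "rf_eval \<alpha>1 \<alpha>2 \<beta> (c_rf 1) = (a 2 + a 3) * a 1"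
      by (rule valI[OF coeffs(3)]) (intro intros; simp)
    thus "c 1 = (a 2 + a 3) * a 1"
      using c by simp
    have "rf_eval \<alpha>1 \<alpha>2 \<beta> (c_rf (n + 2)) =
        (a (3 * n + 5) + a (3 * n + 6)) * a (3 * n + 4) + a (3 * n + 5) * a (3 * n + 3)" for n
      by (rule valI[OF coeffs(4)]) (intro intros; simp)
    thus "c (n + 2) =
        (a (3 * n + 5) + a (3 * n + 6)) * a (3 * n + 4) + a (3 * n + 5) * a (3 * n + 3)" for n
      using c by simp
    have "rf_eval \<alpha>1 \<alpha>2 \<beta> (d_rf (n + 2)) = a (3 * n + 5) * a (3 * n + 3) * a (3 * n + 1)" for n
      by (rule valI[OF coeffs(5)]) (intro intros; simp)
    thus "d (n + 2) = a (3 * n + 5) * a (3 * n + 3) * a (3 * n + 1)" for n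
      using d by simp
  qed
  thus ?thesis
    using a a_rf_pos by auto
qed

end
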